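(* Let $n\ge 2$, let $L\in\mathbb{R}^{n\times n}$ be the weighted Laplacian of an undirected connected graph on $\{1,\dots,n\}$ (so $L=L^\top$ and $0$ is a simple eigenvalue of $L$), let $d\in\mathbb{R}$, and let $x^0\in\mathbb{R}^n$ satisfy $\sum_{i=1}^n x_i^0=d$. Let $f_i:\mathbb{R}\to\mathbb{R}$, $i=1,\dots,n$, be twice continuously differentiable and strongly convex with $0<\delta_i\le f_i''(s)\le\Delta_i$ for all $s\in\mathbb{R}$, for given constants $\delta_i,\Delta_i>0$. Suppose there is $\epsilon<1$ such that for every $x\in\mathbb{R}^n$ $$-\epsilon I_{n-1}\preceq I_{n-1}-M(x)\preceq \epsilon I_{n-1},$$ where $M(x)\in\mathbb{R}^{(n-1)\times(n-1)}$ is the reduced Hessian defined in the context. Let $g(z)=\sum_{i=1}^n f_i(x_i^0+(Lz)_i)$ for $z\in\mathbb{R}^n$, let $q\in\mathbb{N}$, and let $$\alpha=\frac{1-\epsilon}{(n-1)(1+\epsilon)(1-\epsilon^{q+1})}.$$ Then, for any initial condition $z(0)\in\mathbb{R}^n$, the iterates of $$z^{+}=z-\alpha A_q(z)\nabla_z g(z)$$ (with $A_q(z)$ as defined in the context) converge to an optimal solution $z^\star$ of $\min_{z\in\mathbb{R}^n} g(z)$, namely the one uniquely satisfying $\mathbf{1}_n^\top z^\star=\mathbf{1}_n^\top z(0)$, and the convergence is linear in the sense that, at every iterate $z$ with successor $z^+$, $$g(z^+)-g(z)\le -\frac{(1-\epsilon)^4\,(1+\epsilon(-\epsilon)^q)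^2\,\|z-z^\star\|_2^2}{2(n-1)^2(1+\epsilon)^3(1-\epsilon^{2(q+1)})}.$$
   Context: Weighted Laplacian: for an undirected graph on nodes $\{1,\dots,n\}$ with edge weights $w_{ij}=w_{ji}>0$ for edges $\{i,j\}$, $L_{ij}=-w_{ij}$ if $j\neq i$ is a neighbor of $i$, $L_{ii}=\sum_{j}w_{ij}$ (sum over neighbors of $i$), and $L_{ij}=0$ otherwise. Thus $L\succeq 0$ and $L\mathbf{1}_n=\mathbf{0}$, where $\mathbf{1}_n$ is the all-ones vector. $H(x)$ denotes the diagonal Hessian of $f(x)=\sum_i f_i(x_i)$, i.e. $H(x)=\mathrm{diag}(f_1''(x_1),\dots,f_n''(x_n))$. One has $\nabla_z g(z)=L\nabla f(x^0+Lz)$ and $\nabla_{zz}g(z)=LH(x^0+Lz)L$. Reduced Hessian: let $r=1/\sqrt{n(n+1+2\sqrt n)}$ and let $U\in\mathbb{R}^{n\times(n-1)}$ have entries $U_{ii}=r(n-1+\sqrt n)$ for $1\le i\le n-1$, $U_{ij}=-r$ for $1\le i,j\le n-1$, $i\ne j$, and $U_{nj}=-r(1+\sqrt n)$ for $1\le j\le n-1$. (The columns of $U$ form an orthonormal basis of the orthogonal complement of $\mathbf{1}_n$.) Then $M(x):=U^\top LH(x)LU$. For $q\in\mathbb{N}$, $A_q(z):=\sum_{p=0}^q (I_n-LH(x^0+Lz)L)^p$. $A\preceq B$ for symmetric matrices means $B-A$ is positive semidefinite. *)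

theory Defs
  imports "HOL-Analysis.Analysis"
begin

text \<open>
  The node set \<open>{1,\<dots>,n}\<close> with \<open>n \<ge> 2\<close> is the type \<open>'m option\<close> for a finite (nonempty) type \<open>'m\<close> with
  \<open>n - 1\<close> elements: node \<open>n\<close> is \<open>None\<close>, and \<open>Some j\<close> for \<open>j :: 'm\<close> are the nodes \<open>1,\<dots>,n-1\<close>.
  As \<open>'m\<close> is arbitrary, every \<open>n \<ge> 2\<close> is covered.
  A matrix with rows indexed by \<open>'a\<close> and columns indexed by \<open>'b\<close> has type \<open>real^'b^'a\<close>.
\<close>

definition connected_ugraph :: "('a \<times> 'a) set \<Rightarrow> bool" where
  "connected_ugraph E \<longleftrightarrow> sym E \<and> irrefl E \<and> (\<forall>i j. (i, j) \<in> E\<^sup>*)"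

definition edge_weights :: "('a \<times> 'a) set \<Rightarrow> ('a \<Rightarrow> 'a \<Rightarrow> real) \<Rightarrow> bool" where
  "edge_weights E w \<longleftrightarrow> (\<forall>(i, j) \<in> E. w i j = w j i \<and> w i j > 0)"

definition laplacian :: "('a \<times> 'a) set \<Rightarrow> ('a \<Rightarrow> 'a \<Rightarrow> real) \<Rightarrow> real^'a^'a" where
  "laplacian E w = (\<chi> i j. if i = j then (\<Sum>k | (i, k) \<in> E. w i k)
                          else if (i, j) \<in> E then - w i j else 0)"

definition psd :: "real^'a^'a \<Rightarrow> bool" where
  "psd A \<longleftrightarrow> transpose A = A \<and> (\<forall>v. 0 \<le> v \<bullet> (A *v v))"

text \<open>The componentwise order on \<open>real^'a^'a\<close> is unrelated to this one.\<close>

definition loewner_le :: "real^'a^'a \<Rightarrow> real^'a^'a \<Rightarrow> bool" (infix "\<preceq>" 50) where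
  "A \<preceq> B \<longleftrightarrow> psd (B - A)"

text \<open>The library's \<open>*\<close> and \<open>^\<close> on \<open>real^'a^'a\<close> are componentwise; this is the power for \<open>**\<close>.\<close>

primrec matrix_pow :: "real^'a^'a \<Rightarrow> nat \<Rightarrow> real^'a^'a" where
  "matrix_pow A 0 = mat 1"
| "matrix_pow A (Suc p) = A ** matrix_pow A p"

definition gradient :: "('a::euclidean_space \<Rightarrow> real) \<Rightarrow> 'a \<Rightarrow> 'a" where
  "gradient F x = (THE D. GDERIV F x :> D)"

definition strongly_convex :: "real \<Rightarrow> (real \<Rightarrow> real) \<Rightarrow> bool" where
  "strongly_convex \<mu> h \<longleftrightarrow> (\<forall>x y. \<forall>t\<in>{0..1}.
     h (t * x + (1 - t) * y) \<le> t * h x + (1 - t) * h y - \<mu> / 2 * t * (1 - t) * (x - y)\<^sup>2)"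

definition twice_cont_diff :: "(real \<Rightarrow> real) \<Rightarrow> bool" where
  "twice_cont_diff h \<longleftrightarrow> h differentiable_on UNIV \<and> deriv h differentiable_on UNIV \<and>
     continuous_on UNIV (deriv (deriv h))"

definition diag_hessian :: "('a \<Rightarrow> real \<Rightarrow> real) \<Rightarrow> real^'a \<Rightarrow> real^'a^'a" where
  "diag_hessian f x = (\<chi> i j. if i = j then deriv (deriv (f i)) (x $ i) else 0)"

definition basis_U :: "real^'m^('m option)" where
  "basis_U = (let n = real CARD('m option); r = 1 / sqrt (n * (n + 1 + 2 * sqrt n)) in
     \<chi> i j. case i of
         Some k \<Rightarrow> (if k = j then r * (n - 1 + sqrt n) else - r)
       | None \<Rightarrow> - r * (1 + sqrt n))"

definition reduced_hessian ::
  "real^('m option)^('m option) \<Rightarrow> ('m option \<Rightarrow> real \<Rightarrow> real) \<Rightarrow> real^('m option) \<Rightarrow> real^'m^'m" where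
  "reduced_hessian L f x = transpose basis_U ** L ** diag_hessian f x ** L ** basis_U"

definition objective ::
  "real^'a^'a \<Rightarrow> ('a \<Rightarrow> real \<Rightarrow> real) \<Rightarrow> real^'a \<Rightarrow> real^'a \<Rightarrow> real" where
  "objective L f x0 z = (\<Sum>i\<in>UNIV. f i (x0 $ i + (L *v z) $ i))"

definition approx_inverse ::
  "real^'a^'a \<Rightarrow> ('a \<Rightarrow> real \<Rightarrow> real) \<Rightarrow> real^'a \<Rightarrow> nat \<Rightarrow> real^'a \<Rightarrow> real^'a^'a" where
  "approx_inverse L f x0 q z =
     (\<Sum>p=0..q. matrix_pow (mat 1 - L ** diag_hessian f (x0 + L *v z) ** L) p)"

definition is_minimizer :: "('a \<Rightarrow> real) \<Rightarrow> 'a \<Rightarrow> bool" where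
  "is_minimizer F x \<longleftrightarrow> (\<forall>y. F x \<le> F y)"

end

theory Submission
  imports Defs
begin

text \<open>
  On the affine space \<open>z(0) + U u\<close>, which contains all iterates, the objective becomes a function of
  \<open>u \<in> \<real>\<^sup>n\<^sup>-\<^sup>1\<close> with Hessian \<open>M\<close>, and \<open>A\<^sub>q\<close> becomes \<open>P = \<Sum>\<^sub>p\<^sub>\<le>\<^sub>q S\<^sup>p\<close> with \<open>S = I - M\<close>.
  From \<open>- \<epsilon> I \<preceq> S \<preceq> \<epsilon> I\<close> one gets \<open>(1 - \<epsilon>) I \<preceq> P\<close> and \<open>|P v|\<^sup>2 \<le> c \<langle>v, P v\<rangle>\<close> with
  \<open>c = 1 + \<epsilon> + \<dots> + \<epsilon>\<^sup>q\<close>. As \<open>\<alpha> (1 + \<epsilon>) c = 1 / (n - 1) \<le> 1\<close>, a step decreases the objective by at least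
  \<open>\<alpha> / 2 * \<langle>\<nabla>, P \<nabla>\<rangle> \<ge> \<alpha> / 2 * (1 - \<epsilon>)\<^sup>3 |u - u\<^sup>*|\<^sup>2\<close>, which dominates the stated rate. The decreases are
  summable because the objective is bounded below, hence \<open>u\<close> converges to \<open>u\<^sup>*\<close>.
\<close>

declare transpose_matrix_vector [simp del]

section \<open>Truncated Neumann series of a symmetric operator\<close>

locale symmetric_contraction =
  fixes S :: "'a::real_inner \<Rightarrow> 'a" and \<epsilon> :: real
  assumes linear: "linear S"
    and symmetric: "x \<bullet> S y = S x \<bullet> y"
    and form_bound: "\<bar>x \<bullet> S x\<bar> \<le> \<epsilon> * (x \<bullet> x)"
    and eps_nonneg: "0 \<le> \<epsilon>"
begin

text \<open>For a symmetric operator a bound on the quadratic form bounds the norm, by polarization: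
  \<open>S x \<bullet> y\<close> is expressed by the form at \<open>x + y\<close> and
  \<open>x - y\<close>.\<close>

lemma norm_le: "norm (S x) \<le> \<epsilon> * norm x"
proof (cases "S x = 0 \<or> x = 0")
  case True
  then show ?thesis using eps_nonneg linear_0[OF linear] by auto
next
  case False
  \<comment> \<open>\<open>y\<close> is \<open>S x\<close> rescaled to the length of
    \<open>x\<close>, so the parallelogram law turns the two form bounds into one in
    \<open>x\<close> alone.\<close>
  define y where "y = (norm x / norm (S x)) *\<^sub>R S x"
  have yy: "y \<bullet> y = x \<bullet> x"
    using False by (simp add: y_def dot_square_norm power2_eq_square)
  have xy: "S x \<bullet> y = norm x * norm (S x)"
    using False by (simp add: y_def dot_square_norm power2_eq_square)
  have "4 * (S x \<bullet> y) = (x + y) \<bullet> S (x + y) - (x - y) \<bullet> S (x - y)"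
    using symmetric[of x y] symmetric[of y x]
    by (simp add: linear_add[OF linear] linear_diff[OF linear] algebra_simps inner_commute)
  also have "\<dots> \<le> \<epsilon> * ((x + y) \<bullet> (x + y)) + \<epsilon> * ((x - y) \<bullet> (x - y))"
    using form_bound[of "x + y"] form_bound[of "x - y"] by linarith
  also have "\<dots> = 4 * (\<epsilon> * (x \<bullet> x))"
    using yy by (simp add: algebra_simps inner_commute)
  finally have "norm x * norm (S x) \<le> norm x * (\<epsilon> * norm x)"
    using xy by (simp add: dot_square_norm power2_eq_square mult_ac)
  then show ?thesis using False by simp
qed

lemma linear_funpow: "linear (S ^^ p)"
  by (induction p) (simp_all add: linear linear_compose linear_id linear_ident del: o_apply)

lemma symmetric_funpow: "x \<bullet> (S ^^ p) y = (S ^^ p) x \<bullet> y"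
  by (induction p arbitrary: x y) (simp_all add: symmetric funpow_swap1)

lemma norm_funpow_le: "norm ((S ^^ p) x) \<le> \<epsilon> ^ p * norm x"
proof (induction p)
  case (Suc p)
  have "norm ((S ^^ Suc p) x) \<le> \<epsilon> * norm ((S ^^ p) x)" using norm_le by simp
  also have "\<dots> \<le> \<epsilon> * (\<epsilon> ^ p * norm x)" by (intro mult_left_mono Suc eps_nonneg)
  finally show ?case by (simp add: mult_ac)
qed simp

definition neumann :: "nat \<Rightarrow> 'a \<Rightarrow> 'a" where
  "neumann q x = (\<Sum>p=0..q. (S ^^ p) x)"

lemma linear_neumann: "linear (neumann q)"
  unfolding neumann_def using linear_funpow by (intro linear_compose_sum) auto

lemma symmetric_neumann: "x \<bullet> neumann q y = neumann q x \<bullet> y"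
  by (simp add: neumann_def inner_sum_left inner_sum_right symmetric_funpow)

lemma norm_neumann_le: "norm (neumann q x) \<le> (\<Sum>p=0..q. \<epsilon> ^ p) * norm x"
  unfolding neumann_def sum_distrib_right by (intro sum_norm_le norm_funpow_le)

lemma neumann_Suc: "neumann (Suc q) x = x + S (neumann q x)"
  unfolding neumann_def sum.atLeast0_atMost_Suc_shift
  by (simp add: linear_sum[OF linear])

lemma neumann_commute: "neumann q (S x) = S (neumann q x)"
  by (simp add: neumann_def linear_sum[OF linear] funpow_swap1)

text \<open>The coercivity constant does not deteriorate with \<open>q\<close>, since
  \<open>P\<^bsub>q+2\<^esub> = I + S + S P\<^bsub>q\<^esub> S\<close> for the partial sums \<open>P\<^bsub>q\<^esub>\<close>.\<close>

lemma neumann_coercive: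
  assumes "\<epsilon> \<le> 1"
  shows "(1 - \<epsilon>) * (x \<bullet> x) \<le> x \<bullet> neumann q x"
proof (induction q arbitrary: x rule: nat_induct2)
  case 0
  then show ?case using eps_nonneg
    by (simp add: neumann_def algebra_simps)
next
  case 1
  then show ?case using form_bound[of x]
    by (simp add: neumann_def algebra_simps)
next
  case (step q)
  have eq: "x \<bullet> neumann (q + 2) x = x \<bullet> x + x \<bullet> S x + S x \<bullet> neumann q (S x)"
    by (simp add: neumann_Suc linear_add[OF linear] inner_add_right neumann_commute symmetric)
  have "0 \<le> (1 - \<epsilon>) * (S x \<bullet> S x)" using assms by simp
  then have "0 \<le> S x \<bullet> neumann q (S x)" using step[of "S x"] by linarith
  then show ?case using form_bound[of x] eq by (simp add: algebra_simps)
qed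

text \<open>Combining the norm bound with \<open>neumann_coercive\<close> would cost
  \<open>c^2 / (1 - \<epsilon>)\<close>; the factor \<open>c\<close> alone is what lets the step
  size absorb the second-order term of the descent.\<close>

lemma norm_neumann_squared_le:
  assumes "\<epsilon> \<le> 1"
  shows "(norm (neumann q x))\<^sup>2 \<le> (\<Sum>p=0..q. \<epsilon> ^ p) * (x \<bullet> neumann q x)"
proof -
  define P where "P = neumann q"
  define c where "c = (\<Sum>p=0..q. \<epsilon> ^ p)"
  have lin: "linear P" unfolding P_def by (rule linear_neumann)
  have pos: "0 \<le> y \<bullet> P y" for y
  proof -
    have "0 \<le> (1 - \<epsilon>) * (y \<bullet> y)" using assms by simp
    then show ?thesis using neumann_coercive[OF assms, of y q] unfolding P_def by linarith
  qed
  have "(1::real) \<le> c" unfolding c_def sum.atLeast_Suc_atMost[OF le0]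
    by (simp add: sum_nonneg eps_nonneg)
  text \<open>With \<open>c\<close> bounding the norm of \<open>P\<close>, positivity of the form of \<open>P\<close> at \<open>c x - P x\<close> gives
    the claim.\<close>
  have "P x \<bullet> P (P x) \<le> norm (P x) * norm (P (P x))" by (rule norm_cauchy_schwarz)
  also have "\<dots> \<le> norm (P x) * (c * norm (P x))"
    unfolding P_def c_def by (intro mult_left_mono norm_neumann_le) simp
  finally have 1: "P x \<bullet> P (P x) \<le> c * (P x \<bullet> P x)"
    by (simp add: dot_square_norm power2_eq_square mult_ac)
  have "(c *\<^sub>R x - P x) \<bullet> P (c *\<^sub>R x - P x)
      = c * (c * (x \<bullet> P x)) - c * (x \<bullet> P (P x)) - c * (P x \<bullet> P x) + P x \<bullet> P (P x)"
    by (simp add: linear_diff[OF lin] linear_scale[OF lin] inner_diff_left inner_diff_right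
        algebra_simps)
  moreover have "c * (x \<bullet> P (P x)) = c * (P x \<bullet> P x)" unfolding P_def by (simp only: symmetric_neumann)
  ultimately have "0 \<le> c * (c * (x \<bullet> P x)) - 2 * (c * (P x \<bullet> P x)) + P x \<bullet> P (P x)"
    using pos[of "c *\<^sub>R x - P x"] by linarith
  then have "c * (P x \<bullet> P x) \<le> c * (c * (x \<bullet> P x))" using 1 by linarith
  then show ?thesis using \<open>1 \<le> c\<close>
    unfolding P_def[symmetric] c_def[symmetric] by (simp add: dot_square_norm)
qed

end

section \<open>Descent for strongly convex functions\<close>

text \<open>\<open>D\<close> acts as a gradient only through the two quadratic bounds, the form in
  which a Taylor expansion with bounded Hessian delivers them.\<close>

locale strongly_convex_smooth =
  fixes h :: "'a::euclidean_space \<Rightarrow> real" and D :: "'a \<Rightarrow> 'a" and \<mu> \<nu> :: real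
  assumes lower: "h x + D x \<bullet> (y - x) + \<mu> / 2 * (norm (y - x))\<^sup>2 \<le> h y"
    and upper: "h y \<le> h x + D x \<bullet> (y - x) + \<nu> / 2 * (norm (y - x))\<^sup>2"
    and mu_pos: "0 < \<mu>" and nu_pos: "0 < \<nu>"
    and continuous: "continuous_on UNIV h"
begin

lemma strongly_monotone: "\<mu> * (norm (x - y))\<^sup>2 \<le> (D x - D y) \<bullet> (x - y)"
proof -
  have "D x \<bullet> (y - x) = - (D x \<bullet> (x - y))" by (simp add: inner_diff_right)
  then show ?thesis using lower[of x y] lower[of y x]
    by (simp add: norm_minus_commute inner_diff_left)
qed

text \<open>Beyond the radius \<open>R\<close> the quadratic term of \<open>lower\<close> at
  \<open>0\<close> outweighs the linear one, so a minimum over the compact ball is global.\<close>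

lemma ex_minimizer: "\<exists>x. is_minimizer h x"
proof -
  define R where "R = 2 * norm (D 0) / \<mu>"
  have R: "0 \<le> R" using mu_pos by (simp add: R_def)
  obtain x where x: "x \<in> cball 0 R" "\<And>y. y \<in> cball 0 R \<Longrightarrow> h x \<le> h y"
    using continuous_attains_inf[of "cball 0 R" h] R continuous_on_subset[OF continuous]
    by force
  have "h x \<le> h y" for y
  proof (cases "y \<in> cball 0 R")
    case False
    then have "2 * norm (D 0) \<le> \<mu> * norm y"
      using mu_pos by (simp add: R_def field_simps)
    then have "2 * norm (D 0) * norm y \<le> \<mu> * norm y * norm y"
      by (rule mult_right_mono) simp
    then have "norm (D 0) * norm y \<le> \<mu> / 2 * (norm y)\<^sup>2"
      by (simp add: power2_eq_square)
    moreover have "- (norm (D 0) * norm y) \<le> D 0 \<bullet> y"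
      using Cauchy_Schwarz_ineq2[of "D 0" y] by linarith
    ultimately have "h 0 \<le> h y" using lower[of 0 y] by simp
    then show ?thesis using x(2)[of 0] R by simp
  qed (use x in auto)
  then show ?thesis unfolding is_minimizer_def by blast
qed

text \<open>Otherwise, by \<open>upper\<close>, the step \<open>- (1 / \<nu>) *\<^sub>R D x\<close>
  would lower \<open>h\<close> strictly.\<close>

lemma minimizer_gradient_eq_0:
  assumes "is_minimizer h x"
  shows "D x = 0"
proof -
  have "h x \<le> h (x - (1 / \<nu>) *\<^sub>R D x)" using assms by (simp add: is_minimizer_def)
  also have "\<dots> \<le> h x - (norm (D x))\<^sup>2 / (2 * \<nu>)"
    using upper[of "x - (1 / \<nu>) *\<^sub>R D x" x] nu_pos
    by (simp add: dot_square_norm power2_eq_square field_simps)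
  finally show ?thesis using nu_pos by (simp add: divide_le_0_iff)
qed

text \<open>Strong monotonicity against a zero of \<open>D\<close>, with Cauchy-Schwarz. It converts
  decrease measured by the gradient into distance to the minimizer.\<close>

lemma norm_gradient_ge:
  assumes "is_minimizer h s"
  shows "\<mu> * norm (x - s) \<le> norm (D x)"
proof (cases "x = s")
  case False
  have "\<mu> * (norm (x - s))\<^sup>2 \<le> D x \<bullet> (x - s)"
    using strongly_monotone[of x s] minimizer_gradient_eq_0[OF assms] by simp
  also have "\<dots> \<le> norm (D x) * norm (x - s)" by (rule norm_cauchy_schwarz)
  finally show ?thesis using False by (simp add: power2_eq_square)
qed simp

lemma minimizer_unique:
  assumes "is_minimizer h x" "is_minimizer h s"
  shows "x = s"
  using norm_gradient_ge[OF assms(2), of x] minimizer_gradient_eq_0[OF assms(1)] mu_pos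
  by (simp add: mult_le_0_iff)

text \<open>By \<open>upper\<close>, the step gains \<open>\<alpha> * (v \<bullet> w)\<close> to
  first order, and \<open>norm_neumann_squared_le\<close> with this \<open>\<alpha>\<close> keeps
  the second-order cost below half of it. \<open>S\<close> is tied to \<open>h\<close> only through
  \<open>\<epsilon>\<close>, so it may change from one iterate to the next.\<close>

lemma neumann_step_decrease:
  assumes "symmetric_contraction S \<epsilon>" and "\<epsilon> < 1" "\<mu> = 1 - \<epsilon>" "\<nu> = 1 + \<epsilon>"
    and s: "is_minimizer h s" and N: "1 \<le> N"
    and alpha: "\<alpha> = 1 / (N * (1 + \<epsilon>) * (\<Sum>p=0..q. \<epsilon> ^ p))"
  shows "h (x - \<alpha> *\<^sub>R (\<Sum>p=0..q. (S ^^ p) (D x))) - h x \<le> - (\<alpha> / 2 * (1 - \<epsilon>) ^ 3 * (norm (x - s))\<^sup>2)"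
proof -
  interpret S: symmetric_contraction S \<epsilon> by fact
  define c where "c = (\<Sum>p=0..q. \<epsilon> ^ p)"
  define v where "v = D x"
  define w where "w = S.neumann q v"
  have c: "1 \<le> c" unfolding c_def sum.atLeast_Suc_atMost[OF le0]
    by (simp add: sum_nonneg S.eps_nonneg)
  have a: "0 < \<alpha>" using alpha N c S.eps_nonneg unfolding c_def[symmetric] by simp
  have "1 + \<epsilon> \<noteq> 0" "c \<noteq> 0" using c S.eps_nonneg by auto
  then have ac: "\<alpha> * (1 + \<epsilon>) * c = 1 / N" unfolding alpha c_def[symmetric] by simp
  have coercive: "(1 - \<epsilon>) * (v \<bullet> v) \<le> v \<bullet> w"
    unfolding w_def using S.neumann_coercive \<open>\<epsilon> < 1\<close> by simp
  moreover have "0 \<le> (1 - \<epsilon>) * (v \<bullet> v)" using \<open>\<epsilon> < 1\<close> by simp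
  ultimately have vw: "0 \<le> v \<bullet> w" by linarith
  have "\<alpha> * (1 + \<epsilon>) * (norm w)\<^sup>2 \<le> \<alpha> * (1 + \<epsilon>) * (c * (v \<bullet> w))"
    unfolding w_def c_def using S.norm_neumann_squared_le \<open>\<epsilon> < 1\<close> a S.eps_nonneg
    by (intro mult_left_mono) auto
  also have "\<dots> = 1 / N * (v \<bullet> w)" using ac by (metis mult.assoc)
  also have "\<dots> \<le> v \<bullet> w" using N vw by (intro mult_left_le_one_le) auto
  finally have quad: "\<alpha> * (\<alpha> * (1 + \<epsilon>) * (norm w)\<^sup>2) \<le> \<alpha> * (v \<bullet> w)"
    using a by (intro mult_left_mono) auto
  \<comment> \<open>The cube in the claim: one factor \<open>1 - \<epsilon>\<close> comes from
    coercivity, two from the squared gradient bound.\<close>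
  have "(\<mu> * norm (x - s))\<^sup>2 \<le> (norm v)\<^sup>2"
    unfolding v_def using norm_gradient_ge[OF s] mu_pos by (intro power_mono) auto
  then have "(1 - \<epsilon>) * ((1 - \<epsilon>)\<^sup>2 * (norm (x - s))\<^sup>2) \<le> (1 - \<epsilon>) * (v \<bullet> v)"
    using \<open>\<epsilon> < 1\<close> \<open>\<mu> = 1 - \<epsilon>\<close>
    by (intro mult_left_mono) (auto simp: power_mult_distrib dot_square_norm)
  then have "\<alpha> / 2 * ((1 - \<epsilon>) * ((1 - \<epsilon>)\<^sup>2 * (norm (x - s))\<^sup>2)) \<le> \<alpha> / 2 * (v \<bullet> w)"
    using coercive a by (intro mult_left_mono) auto
  then have main: "\<alpha> / 2 * (1 - \<epsilon>) ^ 3 * (norm (x - s))\<^sup>2 \<le> \<alpha> / 2 * (v \<bullet> w)"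
    by (simp add: power2_eq_square power3_eq_cube mult_ac)
  have "h (x - \<alpha> *\<^sub>R w) - h x \<le> - \<alpha> * (v \<bullet> w) + (1 + \<epsilon>) / 2 * (\<alpha>\<^sup>2 * (norm w)\<^sup>2)"
    using upper[of "x - \<alpha> *\<^sub>R w" x] a
    by (simp add: v_def \<open>\<nu> = 1 + \<epsilon>\<close> power_mult_distrib)
  also have "\<dots> \<le> - (\<alpha> / 2 * (v \<bullet> w))"
    using quad by (simp add: power2_eq_square algebra_simps)
  finally show ?thesis using main unfolding w_def S.neumann_def v_def by linarith
qed

end

text \<open>The values decrease and are bounded below by \<open>h s\<close>, hence converge; their
  differences tend to \<open>0\<close> and squeeze the squared distances.\<close>

lemma tendsto_of_sufficient_decrease:
  fixes u :: "nat \<Rightarrow> 'a::real_normed_vector" and h :: "'a \<Rightarrow> real"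
  assumes "\<And>k. h (u (Suc k)) - h (u k) \<le> - (c * (norm (u k - s))\<^sup>2)" and "0 < c"
    and "is_minimizer h s"
  shows "u \<longlonglongrightarrow> s"
proof -
  have dec: "h (u (Suc k)) \<le> h (u k)" for k
  proof -
    have "0 \<le> c * (norm (u k - s))\<^sup>2" using \<open>0 < c\<close> by simp
    then show ?thesis using assms(1)[of k] by linarith
  qed
  have "decseq (\<lambda>k. h (u k))" using dec by (rule decseq_SucI)
  moreover have "h s \<le> h (u k)" for k using assms(3) by (simp add: is_minimizer_def)
  ultimately obtain l where l: "(\<lambda>k. h (u k)) \<longlonglongrightarrow> l"
    using decseq_convergent by metis
  have "(\<lambda>k. (h (u k) - h (u (Suc k))) / c) \<longlonglongrightarrow> (l - l) / c"
    using \<open>0 < c\<close> by (intro tendsto_intros l LIMSEQ_Suc[OF l]) auto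
  then have lim: "(\<lambda>k. (h (u k) - h (u (Suc k))) / c) \<longlonglongrightarrow> 0" by simp
  have "(\<lambda>k. (norm (u k - s))\<^sup>2) \<longlonglongrightarrow> 0"
  proof (rule tendsto_sandwich[OF _ _ tendsto_const lim])
    show "\<forall>\<^sub>F k in sequentially. (norm (u k - s))\<^sup>2 \<le> (h (u k) - h (u (Suc k))) / c"
      using assms(1) \<open>0 < c\<close> by (intro always_eventually allI) (simp add: field_simps; smt (verit))
  qed simp
  then have "(\<lambda>k. sqrt ((norm (u k - s))\<^sup>2)) \<longlonglongrightarrow> sqrt 0" by (rule tendsto_real_sqrt)
  then have "(\<lambda>k. u k - s) \<longlonglongrightarrow> 0" by (simp add: tendsto_norm_zero_iff)
  then show ?thesis by (simp add: LIM_zero_iff)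
qed

text \<open>With \<open>t = \<epsilon> ^ (q + 1)\<close> and
  \<open>1 - t^2 = (1 - t) * (1 + t)\<close> the comparison reduces to \<open>key\<close>. The
  larger constant is the one the descent estimate yields; positivity of the smaller one is used for
  convergence.\<close>

lemma rate_constant_le:
  fixes \<epsilon> N :: real
  assumes "0 \<le> \<epsilon>" "\<epsilon> < 1" "1 \<le> N"
  shows "(1 - \<epsilon>) ^ 4 * (1 + \<epsilon> * (- \<epsilon>) ^ q)\<^sup>2 / (2 * N\<^sup>2 * (1 + \<epsilon>) ^ 3 * (1 - \<epsilon> ^ (2 * (q + 1))))
    \<le> (1 - \<epsilon>) / (N * (1 + \<epsilon>) * (1 - \<epsilon> ^ (q + 1))) / 2 * (1 - \<epsilon>) ^ 3" (is "?l \<le> ?r")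
    and "0 < (1 - \<epsilon>) ^ 4 * (1 + \<epsilon> * (- \<epsilon>) ^ q)\<^sup>2 / (2 * N\<^sup>2 * (1 + \<epsilon>) ^ 3 * (1 - \<epsilon> ^ (2 * (q + 1))))"
proof -
  define t where "t = \<epsilon> ^ (q + 1)"
  have t: "0 \<le> t" "t \<le> \<epsilon>" "t < 1"
    using assms power_decreasing[of 1 "q + 1" \<epsilon>] by (auto simp: t_def simp del: power_Suc)
  have tt: "\<epsilon> ^ (2 * (q + 1)) = t\<^sup>2" by (metis t_def power_mult mult.commute)
  \<comment> \<open>Whatever the parity of \<open>q\<close>, the alternating term has modulus
    \<open>t < 1\<close>, so the squared factor neither vanishes nor exceeds
    \<open>(1 + t)^2\<close>.\<close>
  have ab: "\<bar>\<epsilon> * (- \<epsilon>) ^ q\<bar> = t"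
    using assms by (simp add: t_def abs_mult power_abs)
  then have b: "0 < 1 + \<epsilon> * (- \<epsilon>) ^ q" "1 + \<epsilon> * (- \<epsilon>) ^ q \<le> 1 + t" using t by linarith+
  have "(1 + \<epsilon> * (- \<epsilon>) ^ q)\<^sup>2 \<le> (1 + t) * (1 + t)"
    unfolding power2_eq_square using b by (intro mult_mono) auto
  also have "\<dots> \<le> (1 + \<epsilon>) * (1 + t)" using t by (intro mult_right_mono) auto
  also have "\<dots> \<le> N * (1 + \<epsilon>)\<^sup>2 * (1 + t)"
  proof (intro mult_right_mono)
    have "1 * (1 + \<epsilon>) \<le> (N * (1 + \<epsilon>)) * (1 + \<epsilon>)"
      using assms mult_mono[of 1 N 1 "1 + \<epsilon>"] by (intro mult_right_mono) auto
    then show "1 + \<epsilon> \<le> N * (1 + \<epsilon>)\<^sup>2" by (simp add: power2_eq_square mult_ac)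
  qed (use t in auto)
  finally have key: "(1 + \<epsilon> * (- \<epsilon>) ^ q)\<^sup>2 \<le> N * (1 + \<epsilon>)\<^sup>2 * (1 + t)" .
  define Q where "Q = 2 * N\<^sup>2 * (1 + \<epsilon>) ^ 3 * (1 - t\<^sup>2)"
  have "t\<^sup>2 < 1" using t by (simp add: power_less_one_iff abs_square_less_1)
  then have Q: "0 < Q" using assms by (simp add: Q_def)
  have "?l \<le> (1 - \<epsilon>) ^ 4 * (N * (1 + \<epsilon>)\<^sup>2 * (1 + t)) / Q"
    unfolding tt Q_def[symmetric] using key Q assms
    by (intro divide_right_mono mult_left_mono) auto
  also have "\<dots> = ?r"
  proof -
    have "(1 - \<epsilon>) ^ 4 * (N * (1 + \<epsilon>)\<^sup>2 * (1 + t)) * (N * (1 + \<epsilon>) * (1 - t) * 2)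
      = (1 - \<epsilon>) * (1 - \<epsilon>) ^ 3 * Q"
      unfolding Q_def by algebra
    moreover have "N * (1 + \<epsilon>) * (1 - t) * 2 \<noteq> 0" using assms t by simp
    ultimately show ?thesis using Q unfolding t_def[symmetric]
      by (simp add: frac_eq_eq)
  qed
  finally show "?l \<le> ?r" .
  show "0 < ?l" using Q b assms unfolding tt Q_def by simp
qed

section \<open>The basis of the complement of the constant vectors\<close>

lemma sum_UNIV_option:
  "(\<Sum>i\<in>(UNIV :: 'm::finite option set). F i) = F None + (\<Sum>j\<in>UNIV. F (Some j))"
  by (simp add: UNIV_option_conv sum.reindex)

text \<open>With \<open>s = sqrt n\<close>, the constants of \<^const>\<open>basis_U\<close> are \<open>r = 1 / (s (s + 1))\<close>,
  \<open>r (n - 1 + s) = 1 - r\<close> and \<open>r (1 + s) = 1 / s\<close>.\<close>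

lemma basis_U_entries:
  fixes j k :: "'m::finite"
  defines "s \<equiv> sqrt (real CARD('m option))"
  shows "(basis_U :: real^'m^('m option)) $ None $ j = - 1 / s"
    and "(basis_U :: real^'m^('m option)) $ Some k $ j = (if k = j then 1 else 0) - 1 / (s * (s + 1))"
proof -
  have s: "0 < s" "real CARD('m option) = s\<^sup>2" by (simp_all add: s_def)
  have "sqrt (s\<^sup>2 * (s\<^sup>2 + 1 + 2 * s)) = s * (s + 1)"
    using s by (intro real_sqrt_unique) (auto simp: power2_eq_square algebra_simps)
  then have r: "1 / sqrt (real CARD('m option) * (real CARD('m option) + 1 + 2 * sqrt (real CARD('m option))))
      = 1 / (s * (s + 1))"
    unfolding s_def[symmetric] unfolding s(2) by simp
  have "s + 1 \<noteq> 0" using s(1) by simp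
  then show "(basis_U :: real^'m^('m option)) $ None $ j = - 1 / s"
    unfolding basis_U_def Let_def r unfolding s_def[symmetric] by (simp add: add.commute[of 1 s])
  define p where "p = s * (s + 1)"
  have "p \<noteq> 0" using s(1) by (simp add: p_def)
  moreover have "s\<^sup>2 - 1 + s = p - 1" by (simp add: p_def power2_eq_square algebra_simps)
  ultimately have "1 / (s * (s + 1)) * (s\<^sup>2 - 1 + s) = 1 - 1 / (s * (s + 1))"
    by (simp only: p_def[symmetric]) (simp add: diff_divide_distrib)
  then show "(basis_U :: real^'m^('m option)) $ Some k $ j = (if k = j then 1 else 0) - 1 / (s * (s + 1))"
    unfolding basis_U_def Let_def r unfolding s_def[symmetric] unfolding s(2) by simp
qed

context
  fixes ty :: "'m::finite itself" and s a b N :: real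
  defines "s \<equiv> sqrt (real CARD('m option))" and "a \<equiv> 1 / (s * (s + 1))" and "b \<equiv> 1 / s"
    and "N \<equiv> real CARD('m)"
begin

text \<open>All three follow from \<open>N = s^2 - 1\<close>. Modulo these relations the claims
  about \<open>basis_U\<close> become polynomial identities in \<open>a\<close>, \<open>b\<close>
  and \<open>N\<close>.\<close>

private lemma constants: "N * a = 1 - b" "b * b = a + a * b" "N * (b * b) = 1 - b * b"
proof -
  have s: "0 < s" "N = s * s - 1" by (simp_all add: s_def N_def)
  then have "s \<noteq> 0" "1 + s \<noteq> 0" by simp_all
  then show "N * a = 1 - b" "b * b = a + a * b" "N * (b * b) = 1 - b * b"
    by (simp_all add: a_def b_def s divide_simps) (simp_all add: algebra_simps)
qed

private lemmas entries = basis_U_entries[where 'm = 'm, folded s_def a_def]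

private lemma U_mult:
  fixes v :: "real^'m"
  shows "(basis_U *v v) $ None = - b * (\<Sum>j\<in>UNIV. v $ j)"
    and "(basis_U *v v) $ Some k = v $ k - a * (\<Sum>j\<in>UNIV. v $ j)"
  by (simp_all add: matrix_vector_mult_def entries left_diff_distrib a_def b_def
      sum_subtractf sum_distrib_left sum_negf if_distrib[where f = "\<lambda>x. x * _"] cong: if_cong)

private lemma UT_mult:
  fixes y :: "real^('m option)"
  shows "(transpose basis_U *v y) $ j = y $ Some j - a * (\<Sum>k\<in>UNIV. y $ Some k) - b * y $ None"
  by (simp add: matrix_vector_mult_def transpose_def entries left_diff_distrib a_def b_def
      sum_subtractf sum_distrib_left sum_UNIV_option if_distrib[where f = "\<lambda>x. x * _"] cong: if_cong)

text \<open>Moving along the range of \<open>basis_U\<close> thus preserves the coordinate sum, the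
  invariant that singles out the limit among all minimizers.\<close>

lemma sum_basis_U_mult: "(\<Sum>i\<in>UNIV. ((basis_U :: real^'m^('m option)) *v v) $ i) = 0"
proof -
  define t where "t = (\<Sum>j\<in>UNIV. v $ j)"
  have "(\<Sum>i\<in>UNIV. ((basis_U :: real^'m^('m option)) *v v) $ i) = - b * t + (t - N * (a * t))"
    by (simp add: sum_UNIV_option U_mult sum_subtractf t_def N_def)
  also have "\<dots> = 0" using constants by algebra
  finally show ?thesis .
qed

lemma basis_U_orthonormal: "transpose (basis_U :: real^'m^('m option)) *v (basis_U *v v) = v"
  unfolding vec_eq_iff
proof
  fix j
  define t where "t = (\<Sum>j\<in>UNIV. v $ j)"
  have "(transpose (basis_U :: real^'m^('m option)) *v (basis_U *v v)) $ j
    = v $ j - a * t - a * (t - N * (a * t)) - b * (- b * t)"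
    by (simp add: UT_mult U_mult sum_subtractf t_def N_def)
  also have "\<dots> = v $ j" using constants by algebra
  finally show "(transpose (basis_U :: real^'m^('m option)) *v (basis_U *v v)) $ j = v $ j" .
qed

text \<open>The product is the orthogonal projection that subtracts the mean, as
  \<open>b * b\<close> is \<open>1 / n\<close>. The first form serves where \<open>L\<close>
  annihilates the constant part anyway, the second recovers zero-sum vectors.\<close>

lemma basis_U_projection:
  fixes y :: "real^('m option)"
  shows "\<exists>c. (basis_U :: real^'m^('m option)) *v (transpose basis_U *v y) = y - c *\<^sub>R 1"
    and "(\<Sum>i\<in>UNIV. y $ i) = 0 \<Longrightarrow> (basis_U :: real^'m^('m option)) *v (transpose basis_U *v y) = y"
proof -
  define t where "t = (\<Sum>j\<in>UNIV. y $ Some j)"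
  have sum_y: "(\<Sum>i\<in>UNIV. y $ i) = y $ None + t" by (simp add: sum_UNIV_option t_def)
  have sum_UT: "(\<Sum>j\<in>UNIV. (transpose (basis_U :: real^'m^('m option)) *v y) $ j)
    = t - N * (a * t) - N * (b * y $ None)"
    by (simp add: UT_mult sum_subtractf t_def N_def)
  have eq: "(basis_U :: real^'m^('m option)) *v (transpose basis_U *v y)
    = y - (b * b * (\<Sum>i\<in>UNIV. y $ i)) *\<^sub>R 1"
    unfolding vec_eq_iff
  proof
    fix i :: "'m option"
    show "((basis_U :: real^'m^('m option)) *v (transpose basis_U *v y)) $ i
      = (y - (b * b * (\<Sum>i\<in>UNIV. y $ i)) *\<^sub>R 1) $ i"
    proof (cases i)
      case None
      have "- b * (t - N * (a * t) - N * (b * y $ None)) = y $ None - b * b * (y $ None + t)"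
        using constants by algebra
      then show ?thesis by (simp add: None U_mult sum_UT sum_y)
    next
      case (Some k)
      have "y $ Some k - a * t - b * y $ None - a * (t - N * (a * t) - N * (b * y $ None))
        = y $ Some k - b * b * (y $ None + t)"
        using constants by algebra
      then show ?thesis by (simp add: Some U_mult UT_mult[of y k] sum_UT sum_y t_def)
    qed
  qed
  then show "\<exists>c. (basis_U :: real^'m^('m option)) *v (transpose basis_U *v y) = y - c *\<^sub>R 1" by blast
  show "(basis_U :: real^'m^('m option)) *v (transpose basis_U *v y) = y" if "(\<Sum>i\<in>UNIV. y $ i) = 0"
    unfolding eq that by simp
qed

end

lemma inner_basis_U: "(basis_U *v u) \<bullet> (basis_U *v v) = u \<bullet> (v :: real^'m::finite)"
  by (metis basis_U_orthonormal dot_lmul_matrix inner_commute vector_transpose_matrix)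

lemma norm_basis_U: "norm (basis_U *v v) = norm (v :: real^'m::finite)"
  by (simp add: norm_eq_sqrt_inner inner_basis_U)

lemma inner_matrix_vector_mult: "x \<bullet> (A *v y) = (transpose A *v x) \<bullet> (y :: real^'n::finite)"
  by (metis dot_lmul_matrix transpose_transpose vector_transpose_matrix)

section \<open>The objective function\<close>

lemma laplacian_symmetric:
  assumes "connected_ugraph E" "edge_weights E w"
  shows "transpose (laplacian E w) = laplacian E w"
  using assms
  by (auto simp: vec_eq_iff transpose_def laplacian_def connected_ugraph_def edge_weights_def dest: symD)

lemma laplacian_mult_1:
  fixes E :: "('a::finite \<times> 'a) set"
  assumes "connected_ugraph E"
  shows "laplacian E w *v 1 = 0"
proof -
  \<comment> \<open>Without loops each row is a degree term minus an adjacency row whose diagonal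
    entry is zero.\<close>
  have irr: "(i, i) \<notin> E" for i using assms by (auto simp: connected_ugraph_def irrefl_def)
  have "(\<Sum>j\<in>UNIV. laplacian E w $ i $ j) = 0" for i
  proof -
    have "(\<Sum>j\<in>UNIV. laplacian E w $ i $ j)
      = (\<Sum>j\<in>UNIV. (if i = j then \<Sum>k | (i, k) \<in> E. w i k else 0) - (if (i, j) \<in> E then w i j else 0))"
      using irr by (intro sum.cong) (auto simp: laplacian_def)
    also have "\<dots> = 0" by (simp add: sum_subtractf sum.If_cases)
    finally show ?thesis .
  qed
  then show ?thesis by (simp add: vec_eq_iff matrix_vector_mult_def)
qed

section \<open>Derivative and second-order expansion of the objective\<close>

lemma twice_cont_diff_DERIV:
  assumes "twice_cont_diff f"
  shows "(f has_real_derivative deriv f s) (at s)"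
    and "(deriv f has_real_derivative deriv (deriv f) s) (at s)"
  using assms unfolding twice_cont_diff_def
  by (auto simp: differentiable_on_def DERIV_deriv_iff_real_differentiable)

lemma twice_cont_diff_taylor:
  assumes "twice_cont_diff f"
  shows "\<exists>\<xi>. f y = f x + deriv f x * (y - x) + deriv (deriv f) \<xi> / 2 * (y - x)\<^sup>2"
proof (cases "x = y")
  case False
  have "\<forall>m t. m < 2 \<and> min x y \<le> t \<and> t \<le> max x y \<longrightarrow>
      DERIV ((deriv ^^ m) f) t :> (deriv ^^ Suc m) f t"
    using twice_cont_diff_DERIV[OF assms] by (auto simp: less_2_cases_iff)
  from Taylor[OF _ _ this, of f x y] False obtain \<xi> where
    "f y = (\<Sum>m<2. (deriv ^^ m) f x / fact m * (y - x) ^ m) + (deriv ^^ 2) f \<xi> / fact 2 * (y - x)\<^sup>2"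
    by auto
  then show ?thesis by (auto simp: numeral_2_eq_2)
qed simp

lemma gradient_eqI:
  assumes "GDERIV F x :> D"
  shows "gradient F x = D"
  unfolding gradient_def
proof (rule the_equality[of _ D])
  fix D' assume "GDERIV F x :> D'"
  then have "(\<lambda>h. h \<bullet> D') = (\<lambda>h. h \<bullet> D)"
    using assms unfolding gderiv_def by (rule has_derivative_unique)
  then have "\<forall>h. h \<bullet> D' = h \<bullet> D" by (simp add: fun_eq_iff)
  then show "D' = D" by (simp only: vector_eq_ldot)
qed (fact assms)

definition separable_gradient :: "('a \<Rightarrow> real \<Rightarrow> real) \<Rightarrow> real^'a \<Rightarrow> real^'a" where
  "separable_gradient f x = (\<chi> i. deriv (f i) (x $ i))"

text \<open>Chain rule in each summand; symmetry then moves \<open>L\<close> from the direction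
  \<open>h\<close> onto the gradient of the separable sum.\<close>

lemma objective_has_derivative:
  fixes L :: "real^'a::finite^'a"
  assumes "\<And>i. twice_cont_diff (f i)" and "transpose L = L"
  shows "(objective L f x0 has_derivative
    (\<lambda>h. h \<bullet> (L *v separable_gradient f (x0 + L *v z)))) (at z)"
proof -
  have "((\<lambda>z. f i (x0 $ i + (L *v z) $ i)) has_derivative
      (\<lambda>h. deriv (f i) (x0 $ i + (L *v z) $ i) * (L *v h) $ i)) (at z)" for i
  proof -
    have "((\<lambda>z. (L *v z) $ i) has_derivative (\<lambda>h. (L *v h) $ i)) (at z)"
      by (intro bounded_linear_imp_has_derivative bounded_linear_compose[OF bounded_linear_vec_nth]
          matrix_vector_mul_bounded_linear)
    then have "((\<lambda>z. x0 $ i + (L *v z) $ i) has_derivative (\<lambda>h. (L *v h) $ i)) (at z)"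
      by (auto intro!: derivative_eq_intros)
    from has_derivative_compose[OF this twice_cont_diff_DERIV(1)[OF assms(1), unfolded has_field_derivative_def]]
    show ?thesis .
  qed
  then have "(objective L f x0 has_derivative
    (\<lambda>h. \<Sum>i\<in>UNIV. deriv (f i) (x0 $ i + (L *v z) $ i) * (L *v h) $ i)) (at z)"
    unfolding objective_def by (intro has_derivative_sum) auto
  moreover have "(\<Sum>i\<in>UNIV. deriv (f i) (x0 $ i + (L *v z) $ i) * (L *v h) $ i)
    = h \<bullet> (L *v separable_gradient f (x0 + L *v z))" for h
    by (simp add: inner_matrix_vector_mult assms(2)) (simp add: inner_vec_def separable_gradient_def mult.commute)
  ultimately show ?thesis by simp
qed

lemma diag_hessian_mult: "(diag_hessian f x *v v) $ i = deriv (deriv (f i)) (x $ i) * v $ i"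
  by (simp add: diag_hessian_def matrix_vector_mult_def if_distrib[where f = "\<lambda>x. x * _"] cong: if_cong)

text \<open>Since \<open>f\<close> is separable, Taylor's formula can be applied to each coordinate, and the
  intermediate points make up a single vector \<open>\<xi>\<close>.\<close>

lemma objective_expansion:
  fixes L :: "real^'a::finite^'a"
  assumes "\<And>i. twice_cont_diff (f i)" and "transpose L = L"
  obtains \<xi> where "objective L f x0 (z + v) = objective L f x0 z
    + (L *v separable_gradient f (x0 + L *v z)) \<bullet> v
    + (L *v v) \<bullet> (diag_hessian f \<xi> *v (L *v v)) / 2"
proof -
  define a b where "a = x0 + L *v z" and "b = L *v v"
  have "\<exists>\<xi>. f i (a $ i + b $ i) = f i (a $ i) + deriv (f i) (a $ i) * b $ i
      + deriv (deriv (f i)) \<xi> / 2 * (b $ i)\<^sup>2" for i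
    using twice_cont_diff_taylor[OF assms(1), of i "a $ i + b $ i" "a $ i"] by simp
  then obtain \<xi> where \<xi>: "\<And>i. f i (a $ i + b $ i) = f i (a $ i) + deriv (f i) (a $ i) * b $ i
      + deriv (deriv (f i)) (\<xi> i) / 2 * (b $ i)\<^sup>2"
    by metis
  have "objective L f x0 (z + v) = (\<Sum>i\<in>UNIV. f i (a $ i + b $ i))"
    by (simp add: objective_def a_def b_def matrix_vector_right_distrib add.assoc)
  also have "\<dots> = objective L f x0 z + separable_gradient f a \<bullet> b + b \<bullet> (diag_hessian f (\<chi> i. \<xi> i) *v b) / 2"
    unfolding \<xi>
    by (simp add: sum.distrib objective_def a_def separable_gradient_def inner_vec_def
        diag_hessian_mult sum_divide_distrib power2_eq_square mult_ac)
  also have "separable_gradient f a \<bullet> b = (L *v separable_gradient f a) \<bullet> v"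
    by (simp add: b_def inner_matrix_vector_mult assms(2))
  finally show ?thesis using that unfolding a_def b_def by blast
qed

section \<open>The reduced Hessian and the iteration in reduced coordinates\<close>

lemma reduced_hessian_mult:
  "reduced_hessian L f x *v v
    = transpose basis_U *v (L *v (diag_hessian f x *v (L *v (basis_U *v v))))"
  by (simp add: reduced_hessian_def matrix_vector_mul_assoc matrix_mul_assoc)

text \<open>Matches the form of the reduced Hessian with the remainder in
  \<open>objective_expansion\<close> along directions \<open>basis_U *v v\<close>.\<close>

lemma inner_reduced_hessian:
  assumes "transpose L = L"
  shows "u \<bullet> (reduced_hessian L f x *v v)
    = (L *v (basis_U *v u)) \<bullet> (diag_hessian f x *v (L *v (basis_U *v v)))"
  by (simp add: reduced_hessian_mult inner_matrix_vector_mult assms)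

lemma symmetric_reduced_hessian:
  assumes "transpose L = L"
  shows "u \<bullet> (reduced_hessian L f x *v v) = (reduced_hessian L f x *v u) \<bullet> v"
proof -
  have "transpose (diag_hessian f x) = diag_hessian f x"
    by (simp add: diag_hessian_def transpose_def vec_eq_iff)
  then have "u \<bullet> (reduced_hessian L f x *v v) = v \<bullet> (reduced_hessian L f x *v u)"
    unfolding inner_reduced_hessian[OF assms] by (subst inner_matrix_vector_mult) (simp add: inner_commute)
  then show ?thesis by (simp add: inner_commute)
qed

text \<open>The upper estimate of \<open>I - M\<close> is the lower one of \<open>M\<close> and vice
  versa; they supply the moduli of strong convexity and smoothness.\<close>

lemma reduced_hessian_form_bounds:
  assumes "(- \<epsilon>) *\<^sub>R mat 1 \<preceq> mat 1 - reduced_hessian L f x"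
    and "mat 1 - reduced_hessian L f x \<preceq> \<epsilon> *\<^sub>R mat 1"
  shows "(1 - \<epsilon>) * (v \<bullet> v) \<le> v \<bullet> (reduced_hessian L f x *v v)"
    and "v \<bullet> (reduced_hessian L f x *v v) \<le> (1 + \<epsilon>) * (v \<bullet> v)"
proof -
  have "0 \<le> v \<bullet> ((mat 1 - reduced_hessian L f x - (- \<epsilon>) *\<^sub>R mat 1) *v v)"
    and "0 \<le> v \<bullet> ((\<epsilon> *\<^sub>R mat 1 - (mat 1 - reduced_hessian L f x)) *v v)"
    using assms unfolding loewner_le_def psd_def by blast+
  then show "(1 - \<epsilon>) * (v \<bullet> v) \<le> v \<bullet> (reduced_hessian L f x *v v)"
    and "v \<bullet> (reduced_hessian L f x *v v) \<le> (1 + \<epsilon>) * (v \<bullet> v)"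
    by (simp_all add: matrix_vector_mult_diff_rdistrib scaleR_matrix_vector_assoc[symmetric]
        matrix_vector_mult_add_rdistrib inner_diff_right inner_add_right algebra_simps)
qed

lemma sum_matrix_vector_mult: "sum A I *v x = (\<Sum>i\<in>I. A i *v x)"
  by (induction I rule: infinite_finite_induct) (simp_all add: matrix_vector_mult_add_rdistrib)

text \<open>The range of a symmetric matrix is orthogonal to its kernel. Hence vectors
  \<open>L *v y\<close> are recovered from their coordinates in \<open>basis_U\<close>.\<close>

lemma sum_symmetric_kernel_mult:
  fixes L :: "real^'a::finite^'a"
  assumes "transpose L = L" "L *v 1 = 0"
  shows "(\<Sum>i\<in>UNIV. (L *v y) $ i) = 0"
proof -
  have "(\<Sum>i\<in>UNIV. (L *v y) $ i) = 1 \<bullet> (L *v y)" by (simp add: inner_vec_def)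
  also have "\<dots> = 0" by (simp add: inner_matrix_vector_mult assms)
  finally show ?thesis .
qed

text \<open>\<open>basis_U\<close> intertwines \<open>I - L H L\<close> with \<open>S\<close>: the
  vector \<open>L H L U y\<close> has zero sum, so projecting it onto the range of
  \<open>basis_U\<close> changes nothing. Powers follow by induction.\<close>

lemma approx_inverse_basis_U:
  fixes L :: "real^('m::finite option)^('m option)" and f :: "'m option \<Rightarrow> real \<Rightarrow> real"
  assumes "transpose L = L" "L *v 1 = 0"
  defines "S \<equiv> \<lambda>x v. v - reduced_hessian L f x *v v"
  shows "approx_inverse L f x0 q z *v (basis_U *v v)
    = basis_U *v (\<Sum>p=0..q. (S (x0 + L *v z) ^^ p) v)"
proof -
  define x where "x = x0 + L *v z"
  have "matrix_pow (mat 1 - L ** diag_hessian f x ** L) p *v (basis_U *v v) = basis_U *v ((S x ^^ p) v)" for p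
  proof (induction p)
    case (Suc p)
    define y where "y = (S x ^^ p) v"
    have "basis_U *v (transpose basis_U *v (L *v (diag_hessian f x *v (L *v (basis_U *v y)))))
      = L *v (diag_hessian f x *v (L *v (basis_U *v y)))"
      by (intro basis_U_projection sum_symmetric_kernel_mult assms)
    then have "(mat 1 - L ** diag_hessian f x ** L) *v (basis_U *v y) = basis_U *v S x y"
      by (simp add: matrix_vector_mul_assoc[symmetric] S_def matrix_vector_mult_diff_rdistrib
          matrix_vector_mult_diff_distrib reduced_hessian_mult)
    then show ?case using Suc by (simp add: matrix_vector_mul_assoc[symmetric] y_def)
  qed simp
  then show ?thesis
    by (simp add: approx_inverse_def x_def[symmetric] sum_matrix_vector_mult linear_sum[OF matrix_vector_mul_linear])
qed

section \<open>Convergence of the iteration by reduction to the coordinates of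
  \<open>basis_U\<close>\<close>

theorem theorem2:
  fixes E :: "('m::finite option \<times> 'm option) set"
    and w :: "'m option \<Rightarrow> 'm option \<Rightarrow> real"
    and L :: "real^('m option)^('m option)"
    and f :: "'m option \<Rightarrow> real \<Rightarrow> real"
    and \<delta> \<Delta> :: "'m option \<Rightarrow> real"
    and x0 :: "real^('m option)"
    and z :: "nat \<Rightarrow> real^('m option)"
    and g :: "real^('m option) \<Rightarrow> real"
    and d \<epsilon> \<alpha> :: real
    and n q :: nat
  assumes n: "n = CARD('m option)" "n \<ge> 2"
    and graph: "connected_ugraph E" "edge_weights E w"
    and L: "L = laplacian E w"
    and x0: "(\<Sum>i\<in>UNIV. x0 $ i) = d"
    and bounds_pos: "\<And>i. 0 < \<delta> i" "\<And>i. 0 < \<Delta> i"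
    and f_C2: "\<And>i. twice_cont_diff (f i)"
    and f_strongly_convex: "\<And>i. strongly_convex (\<delta> i) (f i)"
    and f_bounds: "\<And>i s. \<delta> i \<le> deriv (deriv (f i)) s \<and> deriv (deriv (f i)) s \<le> \<Delta> i"
    and eps: "\<epsilon> < 1"
    and M: "\<And>x. (- \<epsilon>) *\<^sub>R mat 1 \<preceq> mat 1 - reduced_hessian L f x \<and>
                 mat 1 - reduced_hessian L f x \<preceq> \<epsilon> *\<^sub>R mat 1"
    and g: "g = objective L f x0"
    and alpha: "\<alpha> = (1 - \<epsilon>) / ((real n - 1) * (1 + \<epsilon>) * (1 - \<epsilon> ^ (q + 1)))"
    and iter: "\<And>k. z (Suc k) = z k - \<alpha> *\<^sub>R (approx_inverse L f x0 q (z k) *v gradient g (z k))"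
  shows "\<exists>zs. is_minimizer g zs \<and> (\<Sum>i\<in>UNIV. zs $ i) = (\<Sum>i\<in>UNIV. z 0 $ i) \<and>
           (\<forall>y. is_minimizer g y \<and> (\<Sum>i\<in>UNIV. y $ i) = (\<Sum>i\<in>UNIV. z 0 $ i) \<longrightarrow> y = zs) \<and>
           z \<longlonglongrightarrow> zs \<and>
           (\<forall>k. g (z (Suc k)) - g (z k) \<le>
              - ((1 - \<epsilon>) ^ 4 * (1 + \<epsilon> * (- \<epsilon>) ^ q)\<^sup>2 * (norm (z k - zs))\<^sup>2 /
                 (2 * (real n - 1)\<^sup>2 * (1 + \<epsilon>) ^ 3 * (1 - \<epsilon> ^ (2 * (q + 1))))))"
proof -
  define U :: "real^'m^('m option)" where "U = basis_U"
  define N where "N = real n - 1"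
  have N: "1 \<le> N" using n(2) by (simp add: N_def)
  have symL: "transpose L = L" and L1: "L *v 1 = 0"
    unfolding L using graph by (simp_all add: laplacian_symmetric laplacian_mult_1)
  note form = reduced_hessian_form_bounds[OF conjunct1[OF M] conjunct2[OF M]]
  \<comment> \<open>The two form bounds at any unit vector give
    \<open>1 - \<epsilon> \<le> 1 + \<epsilon>\<close>.\<close>
  have eps0: "0 \<le> \<epsilon>"
    using form[of "axis undefined 1" undefined] by (simp add: inner_axis_axis)
  define S where "S x v = v - reduced_hessian L f x *v v" for x v
  have S: "symmetric_contraction (S x) \<epsilon>" for x
  proof (rule symmetric_contraction.intro)
    show "linear (S x)" unfolding S_def
      by (intro linear_compose_sub linear_ident matrix_vector_mul_linear)
    show "v \<bullet> S x y = S x v \<bullet> y" for v y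
      by (simp add: S_def inner_diff_left inner_diff_right symmetric_reduced_hessian[OF symL])
    show "\<bar>v \<bullet> S x v\<bar> \<le> \<epsilon> * (v \<bullet> v)" for v
      using form[of v x] by (simp add: S_def inner_diff_right algebra_simps abs_le_iff)
  qed (fact eps0)
  \<comment> \<open>\<open>h\<close> is the objective on the affine space through
    \<open>z 0\<close>, and \<open>D\<close> is its gradient.\<close>
  define h where "h v = g (z 0 + U *v v)" for v
  define D where "D v = transpose U *v (L *v separable_gradient f (x0 + L *v (z 0 + U *v v)))" for v
  have g_deriv: "(g has_derivative (\<lambda>h. h \<bullet> (L *v separable_gradient f (x0 + L *v y)))) (at y)" for y
    unfolding g by (intro objective_has_derivative f_C2 symL)
  \<comment> \<open>The intermediate point \<open>\<xi>\<close> is an arbitrary vector, which the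
    bounds on the reduced Hessian cover because they hold for every \<open>x\<close>.\<close>
  have expand: "\<exists>\<xi>. h (x + v) = h x + D x \<bullet> v + v \<bullet> (reduced_hessian L f \<xi> *v v) / 2" for x v
  proof -
    obtain \<xi> where "g (z 0 + U *v x + U *v v) = g (z 0 + U *v x)
      + (L *v separable_gradient f (x0 + L *v (z 0 + U *v x))) \<bullet> (U *v v)
      + (L *v (U *v v)) \<bullet> (diag_hessian f \<xi> *v (L *v (U *v v))) / 2"
      unfolding g by (rule objective_expansion[OF f_C2 symL])
    then show ?thesis
      by (intro exI[of _ \<xi>])
        (simp add: h_def D_def inner_reduced_hessian[OF symL] U_def[symmetric]
          inner_matrix_vector_mult[of _ U] matrix_vector_right_distrib add.assoc)
  qed
  interpret h: strongly_convex_smooth h D "1 - \<epsilon>" "1 + \<epsilon>"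
  proof
    fix x y
    obtain \<xi> where *: "h y = h x + D x \<bullet> (y - x) + (y - x) \<bullet> (reduced_hessian L f \<xi> *v (y - x)) / 2"
      using expand[of x "y - x"] by auto
    show "h x + D x \<bullet> (y - x) + (1 - \<epsilon>) / 2 * (norm (y - x))\<^sup>2 \<le> h y"
      and "h y \<le> h x + D x \<bullet> (y - x) + (1 + \<epsilon>) / 2 * (norm (y - x))\<^sup>2"
      using form[of "y - x" \<xi>] unfolding * power2_norm_eq_inner times_divide_eq_left by linarith+
  next
    have "continuous_on UNIV g"
      by (intro continuous_at_imp_continuous_on ballI has_derivative_continuous[OF g_deriv])
    moreover have "continuous_on UNIV (\<lambda>v. z 0 + U *v v)"
      by (intro continuous_on_add continuous_on_const linear_continuous_on
          matrix_vector_mul_bounded_linear)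
    ultimately show "continuous_on UNIV h"
      unfolding h_def by (rule continuous_on_compose2) simp
  qed (use eps eps0 in auto)
  obtain us where us: "is_minimizer h us" using h.ex_minimizer by blast
  define zs where "zs = z 0 + U *v us"
  have sumU: "(\<Sum>i\<in>UNIV. (U *v v) $ i) = 0" for v
    unfolding U_def by (rule sum_basis_U_mult)
  have UU: "U *v (transpose U *v y) = y" if "(\<Sum>i\<in>UNIV. y $ i) = 0" for y
    unfolding U_def using that by (rule basis_U_projection)
  \<comment> \<open>Since \<open>L\<close> kills constants, \<open>g\<close> sees \<open>y\<close>
    only modulo constants; so minimizing \<open>h\<close> is minimizing \<open>g\<close> over the
    whole space.\<close>
  have g_h: "g y = h (transpose U *v (y - z 0))" for y
  proof -
    obtain c where c: "U *v (transpose U *v (y - z 0)) = y - z 0 - c *\<^sub>R 1"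
      using basis_U_projection(1) unfolding U_def by blast
    have "L *v (y - c *\<^sub>R 1) = L *v y"
      by (simp add: matrix_vector_mult_diff_distrib matrix_vector_mult_scaleR L1)
    moreover have "z 0 + U *v (transpose U *v (y - z 0)) = y - c *\<^sub>R 1" using c by simp
    ultimately show ?thesis by (simp only: h_def g objective_def)
  qed
  have param: "y = z 0 + U *v (transpose U *v (y - z 0))"
    if "(\<Sum>i\<in>UNIV. y $ i) = (\<Sum>i\<in>UNIV. z 0 $ i)" for y
    using UU[of "y - z 0"] that by (simp add: sum_subtractf)
  have min: "is_minimizer g zs"
    using us by (simp add: is_minimizer_def zs_def g_h U_def basis_U_orthonormal)
  have sum_zs: "(\<Sum>i\<in>UNIV. zs $ i) = (\<Sum>i\<in>UNIV. z 0 $ i)"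
    by (simp add: zs_def sum.distrib sumU)
  have unique: "y = zs"
    if y: "is_minimizer g y" "(\<Sum>i\<in>UNIV. y $ i) = (\<Sum>i\<in>UNIV. z 0 $ i)" for y
  proof -
    have "is_minimizer h (transpose U *v (y - z 0))"
      using y(1) g_h[of y] by (simp add: is_minimizer_def h_def)
    then show ?thesis using h.minimizer_unique[OF _ us] param[OF y(2)] zs_def by metis
  qed
  define u where "u k = transpose U *v (z k - z 0)" for k
  define step where "step k = (\<Sum>p=0..q. (S (x0 + L *v z k) ^^ p)
    (transpose U *v (L *v separable_gradient f (x0 + L *v z k))))" for k
  have z_Suc: "z (Suc k) = z k - \<alpha> *\<^sub>R (U *v step k)" for k
  proof -
    define G where "G = L *v separable_gradient f (x0 + L *v z k)"
    have "gradient g (z k) = G"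
      unfolding G_def using g_deriv by (intro gradient_eqI) (simp add: gderiv_def)
    \<comment> \<open>The gradient lies in the range of \<open>L\<close>, so it has the form
      \<open>U *v v\<close> to which \<open>approx_inverse_basis_U\<close> applies.\<close>
    also have "\<dots> = U *v (transpose U *v G)"
      unfolding G_def by (intro UU[symmetric] sum_symmetric_kernel_mult symL L1)
    finally show ?thesis
      unfolding iter step_def G_def[symmetric] S_def U_def
      by (simp add: approx_inverse_basis_U[OF symL L1])
  qed
  have "(\<Sum>i\<in>UNIV. z k $ i) = (\<Sum>i\<in>UNIV. z 0 $ i)" for k
    by (induction k) (simp_all add: z_Suc sum_subtractf sum_distrib_left[symmetric] sumU)
  then have z_u: "z k = z 0 + U *v u k" for k unfolding u_def by (rule param)
  have u_Suc: "u (Suc k) = u k - \<alpha> *\<^sub>R (\<Sum>p=0..q. (S (x0 + L *v z k) ^^ p) (D (u k)))" for k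
  proof -
    have "u (Suc k) = u k - \<alpha> *\<^sub>R step k"
      by (simp add: u_def z_Suc matrix_vector_mult_diff_distrib matrix_vector_mult_scaleR
          U_def basis_U_orthonormal algebra_simps)
    moreover have "D (u k) = transpose U *v (L *v separable_gradient f (x0 + L *v z k))"
      unfolding D_def z_u[symmetric] ..
    ultimately show ?thesis by (simp add: step_def)
  qed
  \<comment> \<open>The geometric sum puts the step size into the form that
    \<open>neumann_step_decrease\<close> expects.\<close>
  have alpha': "\<alpha> = 1 / (N * (1 + \<epsilon>) * (\<Sum>p=0..q. \<epsilon> ^ p))"
  proof -
    have "(\<Sum>p=0..q. \<epsilon> ^ p) = (1 - \<epsilon> ^ (q + 1)) / (1 - \<epsilon>)"
      using eps sum_gp0[of \<epsilon> q] by (simp add: atMost_atLeast0)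
    then show ?thesis using eps unfolding alpha N_def by simp
  qed
  define c where "c = (1 - \<epsilon>) ^ 4 * (1 + \<epsilon> * (- \<epsilon>) ^ q)\<^sup>2 /
    (2 * N\<^sup>2 * (1 + \<epsilon>) ^ 3 * (1 - \<epsilon> ^ (2 * (q + 1))))"
  have c: "c \<le> \<alpha> / 2 * (1 - \<epsilon>) ^ 3" "0 < c"
    using rate_constant_le[OF eps0 eps N, of q] unfolding c_def alpha N_def by simp_all
  have decrease: "h (u (Suc k)) - h (u k) \<le> - (c * (norm (u k - us))\<^sup>2)" for k
  proof -
    have "h (u (Suc k)) - h (u k) \<le> - (\<alpha> / 2 * (1 - \<epsilon>) ^ 3 * (norm (u k - us))\<^sup>2)"
      unfolding u_Suc by (rule h.neumann_step_decrease[OF S eps refl refl us N alpha'])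
    moreover have "c * (norm (u k - us))\<^sup>2 \<le> \<alpha> / 2 * (1 - \<epsilon>) ^ 3 * (norm (u k - us))\<^sup>2"
      using c by (intro mult_right_mono) auto
    ultimately show ?thesis by linarith
  qed
  \<comment> \<open>\<open>U\<close> is an isometry, so rate and convergence carry over from
    \<open>u\<close> to \<open>z\<close>.\<close>
  have dist: "z k - zs = U *v (u k - us)" for k
    using z_u[of k] by (simp add: zs_def matrix_vector_mult_diff_distrib)
  have norm_dist: "norm (z k - zs) = norm (u k - us)" for k
    unfolding dist U_def by (rule norm_basis_U)
  have "u \<longlonglongrightarrow> us" by (rule tendsto_of_sufficient_decrease[where h = h and u = u, OF decrease c(2) us])
  then have "(\<lambda>k. norm (z k - zs)) \<longlonglongrightarrow> 0"
    unfolding norm_dist by (simp add: tendsto_norm_zero_iff LIM_zero_iff)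
  then have "z \<longlonglongrightarrow> zs" by (simp add: tendsto_norm_zero_iff LIM_zero_iff)
  moreover have "g (z (Suc k)) - g (z k) \<le>
      - ((1 - \<epsilon>) ^ 4 * (1 + \<epsilon> * (- \<epsilon>) ^ q)\<^sup>2 * (norm (z k - zs))\<^sup>2 /
         (2 * (real n - 1)\<^sup>2 * (1 + \<epsilon>) ^ 3 * (1 - \<epsilon> ^ (2 * (q + 1)))))" for k
    using decrease[of k] unfolding c_def N_def times_divide_eq_left
    by (simp only: norm_dist g_h u_def[symmetric])
  ultimately show ?thesis using min sum_zs unique by blast
qed

end
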